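(* For all graphs $G$ and $H$, $$\operatorname{pw}(G\boxtimes H)\geq (\operatorname{pw}(G)+1)(\operatorname{pw}(H)+1)-1.$$
   Context: All graphs are simple, finite and undirected. A path-decomposition of a graph $G$ is a pair $(T,\beta)$ consisting of a path $T$ and a function $\beta:V(T)\to 2^{V(G)}$ such that (i) for every $v\in V(G)$, the set $\{t\in V(T): v\in\beta(t)\}$ is non-empty and induces a connected subgraph of $T$; and (ii) for every edge $uv\in E(G)$ there is $t\in V(T)$ with $\{u,v\}\subseteq\beta(t)$. Its width is $\max_{t\in V(T)}|\beta(t)|-1$. The pathwidth $\operatorname{pw}(G)$ is the minimum width of a path-decomposition of $G$. The strong product $G\boxtimes H$ is the graph with vertex set $V(G)\times V(H)$, where $(g_1,h_1)(g_2,h_2)$ is an edge if and only if $g_1=g_2$ and $h_1h_2\in E(H)$; or $g_1g_2\in E(G)$ and $h_1=h_2$; or $g_1g_2\in E(G)$ and $h_1h_2\in E(H)$. *)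

theory Defs
  imports "Graph_Theory.Digraph_Component"
begin

text \<open>A simple, finite, undirected graph is a \<open>pair_graph\<close>: a finite, symmetric, loop-free
  relation on a finite vertex set, each edge \<open>uv\<close> being the pair of arcs \<open>(u, v)\<close>, \<open>(v, u)\<close>.
  The vertex set may be empty.\<close>

definition path_graph :: "'t pair_pre_digraph \<Rightarrow> bool" where
  "path_graph T \<longleftrightarrow>
     (\<exists>xs. xs \<noteq> [] \<and> distinct xs \<and> pverts T = set xs \<and>
        parcs T = {(xs ! i, xs ! Suc i) | i. Suc i < length xs}
                \<union> {(xs ! Suc i, xs ! i) | i. Suc i < length xs})"

definition path_decomposition ::
    "'a pair_pre_digraph \<Rightarrow> 't pair_pre_digraph \<Rightarrow> ('t \<Rightarrow> 'a set) \<Rightarrow> bool" where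
  "path_decomposition G T \<beta> \<longleftrightarrow>
     path_graph T \<and>
     (\<forall>t \<in> pverts T. \<beta> t \<subseteq> pverts G) \<and>
     (\<forall>v \<in> pverts G. {t \<in> pverts T. v \<in> \<beta> t} \<noteq> {} \<and>
        connected (with_proj T \<restriction> {t \<in> pverts T. v \<in> \<beta> t})) \<and>
     (\<forall>(u, v) \<in> parcs G. \<exists>t \<in> pverts T. {u, v} \<subseteq> \<beta> t)"

text \<open>Widths are integers, since the decomposition of the empty graph into empty bags has
  width \<open>- 1\<close>.\<close>

definition decomposition_width :: "'t pair_pre_digraph \<Rightarrow> ('t \<Rightarrow> 'a set) \<Rightarrow> int" where
  "decomposition_width T \<beta> = int (Max ((\<lambda>t. card (\<beta> t)) ` pverts T)) - 1"

text \<open>Every finite path is isomorphic to one whose vertices are natural numbers, so letting \<open>T\<close>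
  range over these is no restriction.  For a finite graph the minimum exists, see
  \<open>pathwidth_attained\<close> and \<open>pathwidth_le\<close> below.\<close>

definition pathwidth :: "'a pair_pre_digraph \<Rightarrow> int" where
  "pathwidth G =
     (LEAST w. \<exists>(T :: nat pair_pre_digraph) \<beta>.
        path_decomposition G T \<beta> \<and> w = decomposition_width T \<beta>)"

definition strong_product ::
    "'a pair_pre_digraph \<Rightarrow> 'b pair_pre_digraph \<Rightarrow> ('a \<times> 'b) pair_pre_digraph"
    (infixl "\<boxtimes>" 70) where
  "G \<boxtimes> H =
     \<lparr> pverts = pverts G \<times> pverts H,
       parcs = {((g1, h1), (g2, h2)) | g1 h1 g2 h2.
          g1 \<in> pverts G \<and> g2 \<in> pverts G \<and> h1 \<in> pverts H \<and> h2 \<in> pverts H \<and>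
          (g1 = g2 \<and> (h1, h2) \<in> parcs H \<or>
           (g1, g2) \<in> parcs G \<and> h1 = h2 \<or>
           (g1, g2) \<in> parcs G \<and> (h1, h2) \<in> parcs H)} \<rparr>"

lemma pair_graph_strong_product:
  assumes "pair_graph G" and "pair_graph H"
  shows "pair_graph (G \<boxtimes> H)"
proof -
  interpret G: pair_graph G by fact
  interpret H: pair_graph H by fact
  have fin: "finite (pverts (G \<boxtimes> H))"
    by (simp add: strong_product_def)
  have sub: "parcs (G \<boxtimes> H) \<subseteq> pverts (G \<boxtimes> H) \<times> pverts (G \<boxtimes> H)"
    by (auto simp: strong_product_def)
  show ?thesis
  proof unfold_locales
    show "finite (parcs (G \<boxtimes> H))"
      using fin sub by (meson finite_SigmaI finite_subset)
    have "(y, x) \<in> parcs (G \<boxtimes> H)" if "(x, y) \<in> parcs (G \<boxtimes> H)" for x y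
      using that G.arcs_symmetric H.arcs_symmetric
      unfolding strong_product_def by (cases x; cases y) auto
    then show "symmetric (with_proj (G \<boxtimes> H))"
      unfolding symmetric_def by (simp add: sym_def)
    show "fst e \<noteq> snd e" if "e \<in> parcs (G \<boxtimes> H)" for e
      using that by (auto simp: strong_product_def dest: G.no_loops' H.no_loops')
  qed (use fin sub in auto)
qed

lemma decomposition_width_ge: "decomposition_width T \<beta> \<ge> - 1"
  by (simp add: decomposition_width_def)

lemma path_decomposition_trivial:
  assumes "pair_graph G"
  shows "path_decomposition G \<lparr>pverts = {0 :: nat}, parcs = {}\<rparr> (\<lambda>_. pverts G)"
proof -
  interpret G: pair_graph G by fact
  let ?T = "\<lparr>pverts = {0 :: nat}, parcs = {}\<rparr>"
  have "path_graph ?T"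
    unfolding path_graph_def by (rule exI[of _ "[0]"]) auto
  moreover have "connected (with_proj ?T \<restriction> {0})"
    unfolding connected_def
    by (rule strongly_connectedI)
      (auto simp: mk_symmetric_def induce_subgraph_def reachable_def rtrancl_on.intros)
  ultimately show ?thesis
    by (auto simp: path_decomposition_def dest: G.in_arcsD1 G.in_arcsD2)
qed

lemma Least_int_bounded_below:
  fixes P :: "int \<Rightarrow> bool"
  assumes "P k" and "\<And>w. P w \<Longrightarrow> b \<le> w"
  shows "P (Least P)" and "P w \<Longrightarrow> Least P \<le> w"
proof -
  define Q where "Q n \<longleftrightarrow> P (b + int n)" for n
  have P_Q: "Q (nat (w - b)) \<and> b + int (nat (w - b)) = w" if "P w" for w
    using assms(2)[OF that] that by (simp add: Q_def)
  have Q: "Q (Least Q)"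
    using P_Q[OF assms(1)] by (blast intro: LeastI)
  have min: "b + int (Least Q) \<le> w" if "P w" for w
    using P_Q[OF that] Least_le[of Q "nat (w - b)"] by linarith
  have "Least P = b + int (Least Q)"
    using Q min by (intro Least_equality) (auto simp: Q_def)
  then show "P (Least P)" and "P w \<Longrightarrow> Least P \<le> w"
    using Q min by (auto simp: Q_def)
qed

lemma pathwidth_attained:
  assumes "pair_graph G"
  obtains T :: "nat pair_pre_digraph" and \<beta>
  where "path_decomposition G T \<beta>" and "pathwidth G = decomposition_width T \<beta>"
proof -
  have "\<exists>(T :: nat pair_pre_digraph) \<beta>.
      path_decomposition G T \<beta> \<and> pathwidth G = decomposition_width T \<beta>"
    unfolding pathwidth_def
  proof (rule Least_int_bounded_below(1)[where b = "- 1"])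
    show "\<exists>(T :: nat pair_pre_digraph) \<beta>. path_decomposition G T \<beta> \<and>
        decomposition_width \<lparr>pverts = {0 :: nat}, parcs = {}\<rparr> (\<lambda>_. pverts G) =
          decomposition_width T \<beta>"
      using path_decomposition_trivial[OF assms] by (intro exI conjI) (assumption, rule refl)
  qed (use decomposition_width_ge in auto)
  then show ?thesis
    using that by blast
qed

lemma pathwidth_le:
  fixes T :: "nat pair_pre_digraph"
  assumes "path_decomposition G T \<beta>"
  shows "pathwidth G \<le> decomposition_width T \<beta>"
proof -
  define P :: "int \<Rightarrow> bool" where
    "P = (\<lambda>w. \<exists>(T' :: nat pair_pre_digraph) \<beta>'.
       path_decomposition G T' \<beta>' \<and> w = decomposition_width T' \<beta>')"
  have "P (decomposition_width T \<beta>)"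
    unfolding P_def using assms by blast
  moreover have "- 1 \<le> w" if "P w" for w
    using that decomposition_width_ge by (auto simp: P_def)
  ultimately have "Least P \<le> decomposition_width T \<beta>"
    by (intro Least_int_bounded_below(2))
  then show ?thesis
    by (simp add: pathwidth_def P_def)
qed

end

theory Submission
  imports Defs
begin

text \<open>A path-decomposition with bags of size at most \<open>k\<close> amounts to a sweep: a monotone sequence of
  separations of order at most \<open>k\<close> from \<open>({}, V)\<close> to \<open>(V, {})\<close> in which each step changes only one
  side.  If there is no sweep, there is a blockage, which decides consistently which side of each
  separation of order at most \<open>k\<close> is small (Bienstock, Robertson, Seymour and Thomas).  Let
  \<open>(L, R)\<close> be a separation of \<open>G \<boxtimes> H\<close> of order less than \<open>(k + 1) (l + 1)\<close>, with blockages of order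
  \<open>k\<close> in \<open>G\<close> and \<open>l\<close> in \<open>H\<close>.  At most \<open>k\<close> of the fibres \<open>{x} \<times> V(H)\<close> meet \<open>L \<inter> R\<close> in more than \<open>l\<close>
  vertices; on every other fibre the blockage of \<open>H\<close> picks \<open>L\<close> or \<open>R\<close> as the small side, and it picks
  the same side for adjacent \<open>x\<close>.  So \<open>(L, R)\<close> induces a separation of \<open>G\<close> of order at most \<open>k\<close>.
  The side of it chosen by the blockage of \<open>G\<close> stays the same along a sweep of \<open>G \<boxtimes> H\<close>, whereas it
  differs between the two ends.\<close>

section \<open>Separations and sweeps\<close>

text \<open>The separator \<open>A \<inter> B\<close> will become a bag, so \<open>k\<close> bounds
  bag sizes, and sweeps of order \<open>k\<close> correspond to width at most
  \<open>k - 1\<close>.\<close>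

definition separation :: "'a pair_pre_digraph \<Rightarrow> nat \<Rightarrow> 'a set \<Rightarrow> 'a set \<Rightarrow> bool" where
  "separation G k A B \<longleftrightarrow>
     A \<union> B = pverts G \<and> (\<forall>(u, v) \<in> parcs G. {u, v} \<subseteq> A \<or> {u, v} \<subseteq> B) \<and> card (A \<inter> B) \<le> k"

text \<open>As only one side moves, one of the two pairs contains the other componentwise. That is
  the comparison under which the choice of a blockage is stable.\<close>

definition sweep_step :: "'a pair_pre_digraph \<Rightarrow> nat \<Rightarrow> 'a set \<times> 'a set \<Rightarrow> 'a set \<times> 'a set \<Rightarrow> bool" where
  "sweep_step G k p q \<longleftrightarrow>
     separation G k (fst p) (snd p) \<and> separation G k (fst q) (snd q) \<and>
     (fst p = fst q \<and> snd q \<subseteq> snd p \<or> fst p \<subseteq> fst q \<and> snd p = snd q)"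

abbreviation sweep :: "'a pair_pre_digraph \<Rightarrow> nat \<Rightarrow> 'a set \<times> 'a set \<Rightarrow> 'a set \<times> 'a set \<Rightarrow> bool" where
  "sweep G k \<equiv> (sweep_step G k)\<^sup>*\<^sup>*"

lemma separation_commute: "separation G k A B \<Longrightarrow> separation G k B A"
  by (auto simp: separation_def Un_commute Int_commute)

lemma separation_trivial:
  assumes "pair_graph G"
  shows "separation G k {} (pverts G)"
proof -
  interpret pair_graph G by fact
  show ?thesis
    by (auto simp: separation_def dest: in_arcsD1 in_arcsD2)
qed

lemma sweep_separation:
  "sweep G k p q \<Longrightarrow> separation G k (fst p) (snd p) \<Longrightarrow> separation G k (fst q) (snd q)"
  by (induction rule: rtranclp_induct) (auto simp: sweep_step_def)

lemma sweep_mono: "sweep G k p q \<Longrightarrow> fst p \<subseteq> fst q \<and> snd q \<subseteq> snd p"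
  by (induction rule: rtranclp_induct) (auto simp: sweep_step_def)

lemma sweep_reverse: "sweep G k p q \<Longrightarrow> sweep G k (prod.swap q) (prod.swap p)"
proof (induction rule: rtranclp_induct)
  case (step q r)
  have "sweep_step G k (prod.swap r) (prod.swap q)"
    using step(2) by (auto simp: sweep_step_def intro: separation_commute)
  then show ?case
    using step(3) by (rule converse_rtranclp_into_rtranclp)
qed simp

section \<open>Blockages\<close>

definition down_closed :: "'a set set \<Rightarrow> bool" where
  "down_closed P \<longleftrightarrow> (\<forall>X \<in> P. \<forall>Y \<subseteq> X. Y \<in> P)"

definition blockage :: "'a pair_pre_digraph \<Rightarrow> nat \<Rightarrow> 'a set set \<Rightarrow> bool" where
  "blockage G k P \<longleftrightarrow>
     down_closed P \<and> (\<forall>A B. separation G k A B \<longrightarrow> (A \<in> P) \<noteq> (B \<in> P))"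

text \<open>A blockage is found as a maximal unswept down-closed family.\<close>

definition unswept :: "'a pair_pre_digraph \<Rightarrow> nat \<Rightarrow> 'a set set \<Rightarrow> bool" where
  "unswept G k P \<longleftrightarrow>
     (\<forall>A B A' B'. separation G k A B \<longrightarrow> A \<in> P \<longrightarrow> B' \<in> P \<longrightarrow> \<not> sweep G k (A, B) (A', B'))"

lemma separation_sup:
  assumes "separation G i A B" and "separation G j C D" and "card ((C \<union> A) \<inter> (D \<inter> B)) \<le> k"
  shows "separation G k (C \<union> A) (D \<inter> B)"
proof -
  have "{u, v} \<subseteq> C \<union> A \<or> {u, v} \<subseteq> D \<inter> B" if "(u, v) \<in> parcs G" for u v
  proof -
    have "{u, v} \<subseteq> A \<or> {u, v} \<subseteq> B" "{u, v} \<subseteq> C \<or> {u, v} \<subseteq> D"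
      using assms that by (auto simp: separation_def)
    then show ?thesis
      by auto
  qed
  moreover have "(C \<union> A) \<union> (D \<inter> B) = pverts G"
    using assms by (auto simp: separation_def)
  ultimately show ?thesis
    using assms(3) by (auto simp: separation_def)
qed

text \<open>By submodularity of the order, shifting onto a separation of minimum order between \<open>X\<close> and
  \<open>Y\<close> does not increase orders.\<close>

lemma separation_shift:
  assumes "finite (pverts G)"
    and AB: "separation G k A B" and "X \<subseteq> A" and "Y \<subseteq> B"
    and min: "\<And>C D. separation G k C D \<Longrightarrow> X \<subseteq> C \<Longrightarrow> Y \<subseteq> D \<Longrightarrow> card (A \<inter> B) \<le> card (C \<inter> D)"
    and CD: "separation G k C D" and "X \<subseteq> C"
  shows "separation G k (C \<union> A) (D \<inter> B)"
proof -
  let ?S = "(C \<union> A) \<inter> (D \<inter> B)" and ?T = "(C \<inter> A) \<inter> (D \<union> B)"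
  have sub: "A \<union> B = pverts G" "C \<union> D = pverts G"
    using AB CD by (auto simp: separation_def)
  then have fin: "finite A" "finite B" "finite C" "finite D"
    using assms(1) by (metis finite_Un)+
  have "card ?S + card ?T = card (?S \<union> ?T) + card (?S \<inter> ?T)"
    using fin by (intro card_Un_Int) auto
  also have "\<dots> \<le> card ((C \<inter> D) \<union> (A \<inter> B)) + card ((C \<inter> D) \<inter> (A \<inter> B))"
    using fin by (intro add_mono card_mono) auto
  also have "\<dots> = card (C \<inter> D) + card (A \<inter> B)"
    using fin by (intro card_Un_Int[symmetric]) auto
  finally have submod: "card ?S + card ?T \<le> card (C \<inter> D) + card (A \<inter> B)" .
  \<comment> \<open>If \<open>?T\<close> has at most \<open>k\<close> elements, it is the separator
    of a separation between \<open>X\<close> and \<open>Y\<close>, and \<open>min\<close> applies.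
    Otherwise it is larger than \<open>A \<inter> B\<close> anyway.\<close>
  have "card (A \<inter> B) \<le> card ?T"
  proof (cases "card ?T \<le> k")
    case True
    have "separation G k (D \<union> B) (C \<inter> A)"
      using separation_sup[OF separation_commute[OF AB] separation_commute[OF CD]] True
      by (simp add: Int_commute)
    then have "separation G k (C \<inter> A) (D \<union> B)"
      by (rule separation_commute)
    then show ?thesis
      using assms by (intro min) auto
  next
    case False
    then show ?thesis
      using AB by (simp add: separation_def)
  qed
  then have "card ?S \<le> k"
    using submod CD by (simp add: separation_def)
  then show ?thesis
    by (rule separation_sup[OF AB CD])
qed

text \<open>Left sides only grow along a sweep, so they all contain \<open>X\<close>, and
  \<open>separation_shift\<close> applies to every member.\<close>

lemma sweep_shift:
  assumes "finite (pverts G)"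
    and "separation G k A B" and "X \<subseteq> A" and "Y \<subseteq> B"
    and "\<And>C D. separation G k C D \<Longrightarrow> X \<subseteq> C \<Longrightarrow> Y \<subseteq> D \<Longrightarrow> card (A \<inter> B) \<le> card (C \<inter> D)"
    and "sweep G k p q" and "X \<subseteq> fst p"
  shows "sweep G k (fst p \<union> A, snd p \<inter> B) (fst q \<union> A, snd q \<inter> B)"
  using assms(6)
proof (induction rule: rtranclp_induct)
  case (step q r)
  have "X \<subseteq> fst q" "X \<subseteq> fst r"
    using sweep_mono[OF step(1)] sweep_mono[OF r_into_rtranclp, of G k, OF step(2)] assms(7) by auto
  then have "sweep_step G k (fst q \<union> A, snd q \<inter> B) (fst r \<union> A, snd r \<inter> B)"
    using step(2) separation_shift[OF assms(1-5)] by (auto simp: sweep_step_def)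
  then show ?case
    using step(3) by simp
qed simp

text \<open>Adding \<open>X\<close> to \<open>P\<close> creates a forbidden sweep. It involves
  \<open>X\<close>, so up to reversal it starts at a separation \<open>(X, F)\<close>. Joining it
  with \<open>(A, B)\<close> gives a sweep from \<open>(A, F \<inter> B)\<close>, which is one step
  away from \<open>(A, B)\<close>.\<close>

lemma sweep_into_unswept:
  assumes fin: "finite (pverts G)"
    and AB: "separation G k A B" and "X \<subseteq> A" and "Y \<subseteq> B"
    and min: "\<And>C D. separation G k C D \<Longrightarrow> X \<subseteq> C \<Longrightarrow> Y \<subseteq> D \<Longrightarrow> card (A \<inter> B) \<le> card (C \<inter> D)"
    and P: "down_closed P" "unswept G k P" "{S. S \<subseteq> pverts G \<and> card S \<le> k} \<subseteq> P"
    and X: "X \<notin> P" "\<And>Z. Z \<subset> X \<Longrightarrow> Z \<in> P" "\<not> unswept G k (insert X P)"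
  shows "\<exists>C D. D \<in> P \<and> sweep G k (A, B) (C, D)"
proof -
  obtain C D C' D' where CD: "separation G k C D" "C \<in> insert X P" "D' \<in> insert X P"
    and sw: "sweep G k (C, D) (C', D')"
    using X(3) unfolding unswept_def by blast
  have "C = X \<or> D' = X"
    using CD sw P(2) unfolding unswept_def by blast
  then obtain E F E' F' where EF: "separation G k E F" "E = X" "F' \<in> insert X P"
    and sw': "sweep G k (E, F) (E', F')"
  proof
    assume "D' = X"
    then show ?thesis
      using that[of D' C' C D] CD sw sweep_reverse[OF sw] sweep_separation[OF sw]
      by (auto intro: separation_commute)
  qed (use CD sw that in blast)
  \<comment> \<open>The critical case is \<open>F' = X\<close>. If \<open>X\<close> is not inside
    \<open>B\<close>, the intersection is a proper subset of \<open>X\<close>, hence in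
    \<open>P\<close>. If it is, then \<open>X\<close> lies in the separator
    \<open>A \<inter> B\<close>, so it has at most \<open>k\<close> elements and would already be in
    \<open>P\<close>.\<close>
  have "F' \<inter> B \<in> P"
  proof (cases "F' = X \<and> X \<subseteq> B")
    case True
    have AB': "A \<union> B = pverts G" "card (A \<inter> B) \<le> k"
      using AB by (auto simp: separation_def)
    have "X \<subseteq> A \<inter> B"
      using True \<open>X \<subseteq> A\<close> by auto
    moreover have "finite (A \<inter> B)"
      using AB'(1) fin by (metis finite_Un finite_Int)
    ultimately have "card X \<le> k"
      using AB'(2) card_mono order_trans by blast
    then show ?thesis
      using P(3) X(1) \<open>X \<subseteq> A\<close> AB'(1) by blast
  next
    case False
    show ?thesis
    proof (cases "F' = X")
      case True
      then show ?thesis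
        using False by (intro X(2)) auto
    next
      case False
      then show ?thesis
        using EF(3) P(1) by (auto simp: down_closed_def)
    qed
  qed
  moreover have "sweep G k (A, F \<inter> B) (E' \<union> A, F' \<inter> B)"
    using sweep_shift[OF fin AB assms(3,4) min sw'] EF(2) \<open>X \<subseteq> A\<close> by (simp add: Un_absorb1)
  moreover have "sweep_step G k (A, B) (A, F \<inter> B)"
    using separation_shift[OF fin AB assms(3,4) min EF(1)] EF(2) AB \<open>X \<subseteq> A\<close>
    by (auto simp: sweep_step_def Un_absorb1)
  ultimately show ?thesis
    by (meson converse_rtranclp_into_rtranclp)
qed

lemma minimal_subset_not_in:
  assumes "finite A" and "A \<notin> P"
  shows "\<exists>X \<subseteq> A. X \<notin> P \<and> (\<forall>Z. Z \<subset> X \<longrightarrow> Z \<in> P)"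
  using assms
proof (induction A rule: finite_psubset_induct)
  case (psubset A)
  show ?case
  proof (cases "\<exists>Z. Z \<subset> A \<and> Z \<notin> P")
    case True
    then obtain Z where Z: "Z \<subset> A" "Z \<notin> P"
      by blast
    then have "\<exists>X \<subseteq> Z. X \<notin> P \<and> (\<forall>Z. Z \<subset> X \<longrightarrow> Z \<in> P)"
      by (rule psubset.IH)
    then obtain X where "X \<subseteq> Z" "X \<notin> P \<and> (\<forall>Z. Z \<subset> X \<longrightarrow> Z \<in> P)"
      by auto
    then have "X \<subseteq> A" "X \<notin> P \<and> (\<forall>Z. Z \<subset> X \<longrightarrow> Z \<in> P)"
      using Z(1) by (simp_all add: psubset_eq order_trans[of X Z A])
    then show ?thesis
      by blast
  qed (use psubset.prems in blast)
qed

text \<open>Let \<open>P\<close> be maximal. If a separation has neither side in \<open>P\<close>,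
  take minimal sets \<open>X\<close> and \<open>Y\<close> outside \<open>P\<close> in its two sides,
  and a separation of least order between them. From there sweeps lead to small sets in both
  directions, and together they contradict that \<open>P\<close> is unswept.\<close>

lemma blockage_exists:
  assumes "pair_graph G" and no_sweep: "\<not> sweep G k ({}, pverts G) (pverts G, {})"
  obtains P where "blockage G k P"
proof -
  interpret pair_graph G by fact
  let ?V = "pverts G"
  define P0 where "P0 = {S. S \<subseteq> ?V \<and> card S \<le> k}"
  define \<C> where "\<C> = {P. P \<subseteq> Pow ?V \<and> P0 \<subseteq> P \<and> down_closed P \<and> unswept G k P}"
  have "unswept G k P0"
    unfolding unswept_def
  proof (intro allI impI notI)
    fix A B A' B'
    assume AB: "separation G k A B" "A \<in> P0" "B' \<in> P0" "sweep G k (A, B) (A', B')"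
    \<comment> \<open>A set \<open>C\<close> of at most \<open>k\<close> vertices can be added to
      the left side while the right side is still everything; then the right side shrinks to
      \<open>D\<close>.\<close>
    have to_small: "sweep G k ({}, ?V) (C, D)" if "separation G k C D" "C \<in> P0" for C D
    proof -
      have "separation G k C ?V"
        using that by (auto simp: separation_def P0_def Int_absorb2 dest: in_arcsD1 in_arcsD2)
      moreover have "D \<subseteq> ?V"
        using that by (auto simp: separation_def)
      ultimately have "sweep_step G k ({}, ?V) (C, ?V)" "sweep_step G k (C, ?V) (C, D)"
        using that separation_trivial[OF assms(1)] by (simp_all add: sweep_step_def)
      then show ?thesis
        by (rule converse_rtranclp_into_rtranclp[OF _ r_into_rtranclp])
    qed
    have "sweep G k ({}, ?V) (A, B)"
      using AB to_small by blast
    moreover have "sweep G k ({}, ?V) (B', A')"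
    proof (rule to_small)
      show "separation G k B' A'"
        using AB(1) sweep_separation[OF AB(4)] by (simp add: separation_commute)
    qed fact
    then have "sweep G k (A', B') (?V, {})"
      using sweep_reverse[of G k "({}, ?V)" "(B', A')"] by simp
    ultimately have "sweep G k ({}, ?V) (?V, {})"
      using AB(4) rtranclp_trans[of "sweep_step G k"] by metis
    then show False
      using no_sweep by contradiction
  qed
  moreover have "down_closed P0"
    unfolding down_closed_def
  proof (intro ballI allI impI)
    fix X Y
    assume "X \<in> P0" "Y \<subseteq> X"
    then have "Y \<subseteq> ?V" "card Y \<le> card X" "card X \<le> k"
      using finite_subset[OF _ finite_verts] by (auto simp: P0_def intro: card_mono)
    then show "Y \<in> P0"
      by (simp add: P0_def)
  qed
  ultimately have "P0 \<in> \<C>"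
    by (auto simp: \<C>_def P0_def)
  moreover have "finite \<C>"
    by (rule finite_subset[of _ "Pow (Pow ?V)"]) (auto simp: \<C>_def)
  ultimately have "\<exists>P \<in> \<C>. P0 \<subseteq> P \<and> (\<forall>Q \<in> \<C>. P \<subseteq> Q \<longrightarrow> P = Q)"
    by (intro finite_has_maximal2)
  then obtain P where "P \<in> \<C>" and max: "\<And>Q. Q \<in> \<C> \<Longrightarrow> P \<subseteq> Q \<Longrightarrow> P = Q"
    by auto
  then have P: "P \<subseteq> Pow ?V" "P0 \<subseteq> P" "down_closed P" "unswept G k P"
    by (auto simp: \<C>_def)
  \<comment> \<open>Since all proper subsets of \<open>X\<close> are in \<open>P\<close>, adding
    \<open>X\<close> preserves down-closure; by maximality of \<open>P\<close> only unsweptness can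
    fail.\<close>
  have minimal: "\<not> unswept G k (insert X P)"
    if "X \<subseteq> ?V" "X \<notin> P" "\<And>Z. Z \<subset> X \<Longrightarrow> Z \<in> P" for X
  proof
    assume "unswept G k (insert X P)"
    moreover have "down_closed (insert X P)"
      using P(3) that(3) unfolding down_closed_def by (metis insert_iff psubsetI)
    ultimately have "insert X P \<in> \<C>"
      using P that(1) by (auto simp: \<C>_def)
    then show False
      using max that(2) by blast
  qed
  have "(A \<in> P) \<noteq> (B \<in> P)" if AB: "separation G k A B" for A B
  proof (rule ccontr)
    assume eq: "\<not> (A \<in> P) \<noteq> (B \<in> P)"
    \<comment> \<open>The sweep of length zero from \<open>(A, B)\<close> to itself excludes
      this.\<close>
    have "\<not> (A \<in> P \<and> B \<in> P)"
      using P(4) AB unfolding unswept_def by blast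
    with eq have notin: "A \<notin> P" "B \<notin> P"
      by auto
    have V: "A \<subseteq> ?V" "B \<subseteq> ?V"
      using AB by (auto simp: separation_def)
    have fin: "finite A" "finite B"
      using V finite_subset[OF _ finite_verts] by blast+
    obtain X where X: "X \<subseteq> A" "X \<notin> P" "\<And>Z. Z \<subset> X \<Longrightarrow> Z \<in> P"
      using minimal_subset_not_in[OF fin(1) notin(1)] by blast
    obtain Y where Y: "Y \<subseteq> B" "Y \<notin> P" "\<And>Z. Z \<subset> Y \<Longrightarrow> Z \<in> P"
      using minimal_subset_not_in[OF fin(2) notin(2)] by blast
    define between where
      "between = (\<lambda>(C, D). separation G k C D \<and> X \<subseteq> C \<and> Y \<subseteq> D)"
    obtain C D where CD: "between (C, D)"
      and min: "\<And>E F. between (E, F) \<Longrightarrow> card (C \<inter> D) \<le> card (E \<inter> F)"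
      using ex_has_least_nat[of between "(A, B)" "\<lambda>(C, D). card (C \<inter> D)"] AB X Y
      by (auto simp: between_def)
    have CD': "separation G k C D" "X \<subseteq> C" "Y \<subseteq> D"
      using CD by (auto simp: between_def)
    have card_le: "card (C \<inter> D) \<le> card (E \<inter> F)"
      if "separation G k E F" "X \<subseteq> E" "Y \<subseteq> F" for E F
      using min that by (simp add: between_def)
    have small: "{S. S \<subseteq> ?V \<and> card S \<le> k} \<subseteq> P"
      using P(2) by (simp add: P0_def)
    have XY: "\<not> unswept G k (insert X P)" "\<not> unswept G k (insert Y P)"
      using minimal[OF subset_trans[OF X(1) V(1)] X(2,3)]
        minimal[OF subset_trans[OF Y(1) V(2)] Y(2,3)] by simp_all
    obtain E F where EF: "F \<in> P" "sweep G k (C, D) (E, F)"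
      using sweep_into_unswept[OF finite_verts CD' card_le P(3,4) small X(2,3) XY(1)] by blast
    have "card (D \<inter> C) \<le> card (E \<inter> F)"
      if "separation G k E F" "Y \<subseteq> E" "X \<subseteq> F" for E F
      using card_le[OF separation_commute[OF that(1)] that(3,2)] by (simp add: Int_commute)
    then obtain E' F' where EF': "F' \<in> P" "sweep G k (D, C) (E', F')"
      using sweep_into_unswept[OF finite_verts separation_commute[OF CD'(1)] CD'(3,2) _ P(3,4)
          small Y(2,3) XY(2)] by blast
    \<comment> \<open>The reversed second sweep leads from \<open>(F', E')\<close> to
      \<open>(C, D)\<close>, where the first one takes over. Both \<open>F'\<close> and
      \<open>F\<close> are in \<open>P\<close>.\<close>
    have "sweep G k (F', E') (E, F)"
      using sweep_reverse[OF EF'(2)] EF(2) by (simp add: rtranclp_trans)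
    moreover have "separation G k F' E'"
      using sweep_separation[OF EF'(2)] CD' by (auto intro: separation_commute)
    ultimately show False
      using P(4) EF EF' unfolding unswept_def by blast
  qed
  then have "blockage G k P"
    using P by (simp add: blockage_def)
  then show ?thesis
    by (rule that)
qed

section \<open>Sweeps and path-decompositions\<close>

lemma parcs_mk_symmetric_induced:
  "parcs (mk_symmetric (with_proj T \<restriction> S)) =
     {(x, y). x \<in> S \<and> y \<in> S \<and> ((x, y) \<in> parcs T \<or> (y, x) \<in> parcs T)}"
  by (force simp: parcs_mk_symmetric induce_subgraph_def)

lemma connected_interval:
  assumes T: "pverts T = {..n}" "parcs T = {(i, Suc i) | i. i < n} \<union> {(Suc i, i) | i. i < n}"
    and S: "S \<subseteq> {..n}" "S \<noteq> {}"
    and convex: "\<And>i j l. i \<in> S \<Longrightarrow> l \<in> S \<Longrightarrow> i \<le> j \<Longrightarrow> j \<le> l \<Longrightarrow> j \<in> S"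
  shows "connected (with_proj T \<restriction> S)"
proof -
  define K where "K = with_proj (mk_symmetric (with_proj T \<restriction> S))"
  have verts: "verts K = S"
    by (simp add: K_def)
  have arc: "(i, Suc i) \<in> arcs_ends K" "(Suc i, i) \<in> arcs_ends K" if "i \<in> S" "Suc i \<in> S" for i
    using that S(1) T(2) by (auto simp: K_def parcs_mk_symmetric_induced)
  have "i \<rightarrow>\<^sup>*\<^bsub>K\<^esub> j \<and> j \<rightarrow>\<^sup>*\<^bsub>K\<^esub> i" if "i \<le> j" "i \<in> S" "j \<in> S" for i j
    using that
  proof (induction j rule: dec_induct)
    case base
    then show ?case
      by (simp add: reachable_def verts)
  next
    case (step m)
    have "m \<in> S"
      using convex[of i "Suc m" m] step by simp
    then have "(i, m) \<in> rtrancl_on S (arcs_ends K)" "(m, i) \<in> rtrancl_on S (arcs_ends K)"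
      using step by (auto simp: reachable_def verts)
    moreover have "(Suc m, m) \<in> rtrancl_on S (arcs_ends K)"
      using arc[of m] \<open>m \<in> S\<close> step.prems
      by (meson rtrancl_on.rtrancl_on_into_rtrancl_on rtrancl_on.rtrancl_on_refl)
    ultimately show ?case
      using arc[of m] \<open>m \<in> S\<close> step.prems unfolding reachable_def verts
      by (meson rtrancl_on.rtrancl_on_into_rtrancl_on rtrancl_on_trans)
  qed
  then have "i \<rightarrow>\<^sup>*\<^bsub>K\<^esub> j" if "i \<in> S" "j \<in> S" for i j
    using that nat_le_linear by blast
  then show ?thesis
    using S(2) unfolding connected_def K_def[symmetric] by (intro strongly_connectedI) (auto simp: verts)
qed

text \<open>The separators of the successive separations serve as bags. A vertex occupies an
  interval of bags because left sides grow and right sides shrink.\<close>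

lemma pathwidth_le_if_sweep:
  assumes "pair_graph G" and "sweep G k ({}, pverts G) (pverts G, {})"
  shows "pathwidth G + 1 \<le> int k"
proof -
  obtain n f where f: "f 0 = ({}, pverts G)" "f n = (pverts G, {})"
    and step: "\<And>i. i < n \<Longrightarrow> sweep_step G k (f i) (f (Suc i))"
    using rtranclp_imp_relpowp[OF assms(2)] unfolding relpowp_fun_conv by blast
  define L where "L i = fst (f i)" for i
  define R where "R i = snd (f i)" for i
  have sep: "separation G k (L i) (R i)" if "i \<le> n" for i
    using that f(1) separation_trivial[OF assms(1)] step[of "i - 1"]
    by (cases i) (auto simp: L_def R_def sweep_step_def)
  have mono: "L i \<subseteq> L j \<and> R j \<subseteq> R i" if "i \<le> j" "j \<le> n" for i j
    using that
  proof (induction j rule: dec_induct)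
    case (step m)
    have "L m \<subseteq> L (Suc m) \<and> R (Suc m) \<subseteq> R m"
      using \<open>\<And>i. i < n \<Longrightarrow> sweep_step G k (f i) (f (Suc i))\<close>[of m] step.prems
      by (auto simp: L_def R_def sweep_step_def)
    then show ?case
      using step by auto
  qed simp
  define T where
    "T = \<lparr>pverts = {..n}, parcs = {(i, Suc i) | i. i < n} \<union> {(Suc i, i) | i. i < n}\<rparr>"
  define \<beta> where "\<beta> i = L i \<inter> R i" for i
  \<comment> \<open>At the first index \<open>m\<close> with \<open>S \<subseteq> L m\<close>, the
    preceding separation has \<open>S\<close> on its right. The step to \<open>m\<close> changes the
    left side, hence leaves the right side alone, and \<open>S\<close> lies in the bag at
    \<open>m\<close>. This serves single vertices and edges alike.\<close>
  have covered: "\<exists>i \<in> pverts T. S \<subseteq> \<beta> i"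
    if "S \<noteq> {}" "S \<subseteq> pverts G" "\<And>i. i \<le> n \<Longrightarrow> S \<subseteq> L i \<or> S \<subseteq> R i" for S
  proof -
    define m where "m = (LEAST i. S \<subseteq> L i)"
    have "S \<subseteq> L n"
      using that(2) f(2) by (simp add: L_def)
    then have m: "S \<subseteq> L m" "m \<le> n"
      unfolding m_def by (fact LeastI, fact Least_le)
    then have "m \<noteq> 0"
      using f(1) that(1) by (auto simp: L_def intro!: Nat.gr0I)
    then obtain i where i: "m = Suc i"
      using not0_implies_Suc by blast
    then have "\<not> S \<subseteq> L i"
      using not_less_Least[of i "\<lambda>i. S \<subseteq> L i"] by (simp add: m_def)
    then have "S \<subseteq> R i" "L i \<noteq> L m"
      using that(3)[of i] i m by auto
    moreover have "sweep_step G k (f i) (f m)"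
      using step[of i] i m(2) by simp
    ultimately have "S \<subseteq> R m"
      by (auto simp: sweep_step_def L_def R_def)
    then show ?thesis
      using m by (auto simp: T_def \<beta>_def)
  qed
  have "path_graph T"
    unfolding path_graph_def
  proof (intro exI[of _ "[0..<Suc n]"] conjI)
    show "parcs T =
        {([0..<Suc n] ! i, [0..<Suc n] ! Suc i) | i. Suc i < length [0..<Suc n]}
      \<union> {([0..<Suc n] ! Suc i, [0..<Suc n] ! i) | i. Suc i < length [0..<Suc n]}"
      unfolding T_def pair_pre_digraph.simps
      by (intro arg_cong2[of _ _ _ _ "(\<union>)"] Collect_cong ex_cong1) (auto simp del: upt_Suc)
  qed (auto simp: T_def simp del: upt_Suc)
  moreover have "\<beta> i \<subseteq> pverts G" if "i \<in> pverts T" for i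
    using sep[of i] that by (auto simp: T_def \<beta>_def separation_def)
  moreover have "{t \<in> pverts T. v \<in> \<beta> t} \<noteq> {}" if "v \<in> pverts G" for v
    using covered[of "{v}"] sep that by (auto simp: separation_def)
  moreover have "connected (with_proj T \<restriction> {t \<in> pverts T. v \<in> \<beta> t})" if "v \<in> pverts G" for v
  proof (rule connected_interval)
    show "{t \<in> pverts T. v \<in> \<beta> t} \<noteq> {}"
      using covered[of "{v}"] sep that by (auto simp: separation_def)
    show "j \<in> {t \<in> pverts T. v \<in> \<beta> t}"
      if "i \<in> {t \<in> pverts T. v \<in> \<beta> t}" "l \<in> {t \<in> pverts T. v \<in> \<beta> t}" "i \<le> j" "j \<le> l" for i j l
      using that mono[of i j] mono[of j l] by (auto simp: T_def \<beta>_def)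
  qed (auto simp: T_def)
  moreover have "\<exists>t \<in> pverts T. {u, v} \<subseteq> \<beta> t" if "(u, v) \<in> parcs G" for u v
  proof (rule covered)
    interpret pair_graph G by fact
    show "{u, v} \<subseteq> pverts G"
      using that by (auto dest: in_arcsD1 in_arcsD2)
    show "{u, v} \<subseteq> L i \<or> {u, v} \<subseteq> R i" if "i \<le> n" for i
      using sep[OF that] \<open>(u, v) \<in> parcs G\<close> by (auto simp: separation_def)
  qed simp
  ultimately have "path_decomposition G T \<beta>"
    unfolding path_decomposition_def by blast
  then have "pathwidth G \<le> decomposition_width T \<beta>"
    by (rule pathwidth_le)
  also have "Max ((\<lambda>t. card (\<beta> t)) ` pverts T) \<le> k"
    using sep by (intro Max.boundedI) (auto simp: T_def \<beta>_def separation_def)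
  then have "decomposition_width T \<beta> \<le> int k - 1"
    by (simp add: decomposition_width_def)
  finally show ?thesis
    by simp
qed

lemma connected_path_convex:
  assumes xs: "distinct xs"
    and arcs: "parcs T = {(xs ! i, xs ! Suc i) | i. Suc i < length xs}
                       \<union> {(xs ! Suc i, xs ! i) | i. Suc i < length xs}"
    and conn: "connected (with_proj T \<restriction> S)"
    and "xs ! i \<in> S" "xs ! l \<in> S" "i \<le> j" "j \<le> l" "l < length xs"
  shows "xs ! j \<in> S"
proof (rule ccontr)
  assume notin: "xs ! j \<notin> S"
  then have "i \<noteq> j" "j \<noteq> l"
    using assms by auto
  then have "i < j" "j < l"
    using assms by auto
  define K where "K = with_proj (mk_symmetric (with_proj T \<restriction> S))"
  have "xs ! i \<rightarrow>\<^sup>*\<^bsub>K\<^esub> xs ! l"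
    using conn assms unfolding connected_def strongly_connected_def K_def[symmetric]
    by (simp add: K_def)
  then have "(xs ! i, xs ! l) \<in> rtrancl_on S (arcs_ends K)"
    by (simp add: reachable_def K_def)
  then have "\<exists>m < j. xs ! l = xs ! m"
  proof (induction rule: rtrancl_on_induct)
    case (step x y)
    then obtain m where m: "m < j" "x = xs ! m"
      by blast
    have "(x, y) \<in> parcs T \<or> (y, x) \<in> parcs T"
      using step(2) by (auto simp: K_def parcs_mk_symmetric_induced)
    then obtain a b where ab: "x = xs ! a" "y = xs ! b" "a < length xs" "b < length xs"
      "b = Suc a \<or> a = Suc b"
      unfolding arcs by auto
    then have "a = m"
      using m xs nth_eq_iff_index_eq[of xs a m] \<open>j < l\<close> \<open>l < length xs\<close> by simp
    moreover have "b \<noteq> j"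
      using ab step(4) notin by auto
    ultimately have "b < j"
      using ab m by auto
    then show ?case
      using ab by blast
  qed (use \<open>i < j\<close> in blast)
  then obtain m where "m < j" "xs ! l = xs ! m"
    by blast
  then show False
    using nth_eq_iff_index_eq[OF xs, of l m] \<open>j < l\<close> \<open>l < length xs\<close> by simp
qed

text \<open>The left side is the union of the bags before a position and the right side the union of
  the bags from it on. Advancing by one position takes two steps: bag \<open>b i\<close> first joins
  the left side, then the right side drops it.\<close>

lemma sweep_if_path_decomposition:
  assumes "pair_graph G" and pd: "path_decomposition G T \<beta>"
    and card: "\<And>t. t \<in> pverts T \<Longrightarrow> card (\<beta> t) \<le> k"
  shows "sweep G k ({}, pverts G) (pverts G, {})"
proof -
  interpret pair_graph G by fact
  obtain xs where xs: "distinct xs" "pverts T = set xs"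
    and arcs: "parcs T = {(xs ! i, xs ! Suc i) | i. Suc i < length xs}
                       \<union> {(xs ! Suc i, xs ! i) | i. Suc i < length xs}"
  proof -
    have "path_graph T"
      using pd by (simp add: path_decomposition_def)
    then show ?thesis
      using that unfolding path_graph_def by (elim exE conjE)
  qed
  define n where "n = length xs"
  define b where "b i = \<beta> (xs ! i)" for i
  define L where "L i = (\<Union>j \<in> {..<i}. b j)" for i
  define R where "R i = (\<Union>j \<in> {i..<n}. b j)" for i
  have bag: "b i \<subseteq> pverts G" "card (b i) \<le> k" if "i < n" for i
    using pd card that xs by (auto simp: path_decomposition_def b_def n_def)
  have covers: "\<exists>i < n. {u, v} \<subseteq> b i" if "(u, v) \<in> parcs G" for u v
    using pd that xs by (fastforce simp: path_decomposition_def b_def n_def in_set_conv_nth)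
  have covers1: "\<exists>i < n. v \<in> b i" if "v \<in> pverts G" for v
    using pd that xs by (fastforce simp: path_decomposition_def b_def n_def in_set_conv_nth)
  have convex: "v \<in> b j" if "v \<in> b i" "v \<in> b l" "i \<le> j" "j \<le> l" "l < n" for v i j l
  proof -
    let ?S = "{t \<in> pverts T. v \<in> \<beta> t}"
    have "v \<in> pverts G"
      using bag that by auto
    then have "connected (with_proj T \<restriction> ?S)"
      using pd by (auto simp: path_decomposition_def)
    moreover have "xs ! i \<in> ?S" "xs ! l \<in> ?S"
      using that by (simp_all add: xs(2) b_def n_def)
    ultimately have "xs ! j \<in> ?S"
      using connected_path_convex[OF xs(1) arcs, of ?S i l j] that(3-5) n_def by blast
    then show ?thesis
      by (simp add: b_def)
  qed
  \<comment> \<open>The range of \<open>i'\<close> covers both \<open>(L i, R i)\<close> and the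
    intermediate \<open>(L (Suc i), R i)\<close>. For \<open>i < n\<close> the separator is inside
    \<open>b i\<close> by convexity; for \<open>i = n\<close> the right side is empty.\<close>
  have sep: "separation G k (L i') (R i)" if "i \<le> i'" "i' \<le> Suc i" "i' \<le> n" for i i'
  proof -
    have split: "j \<in> {..<i'} \<or> j \<in> {i..<n}" if "j < n" for j
      using that \<open>i \<le> i'\<close> by auto
    have "L i' \<union> R i \<subseteq> pverts G"
    proof
      fix v
      assume "v \<in> L i' \<union> R i"
      then obtain j where "j < n" "v \<in> b j"
        using \<open>i' \<le> n\<close> by (auto simp: L_def R_def dest: order_less_le_trans)
      then show "v \<in> pverts G"
        using bag(1) by auto
    qed
    moreover have "v \<in> L i' \<union> R i" if "v \<in> pverts G" for v
      using covers1[OF that] split unfolding L_def R_def by blast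
    ultimately have "L i' \<union> R i = pverts G"
      by auto
    moreover have "{u, v} \<subseteq> L i' \<or> {u, v} \<subseteq> R i" if "(u, v) \<in> parcs G" for u v
      using covers[OF that] split unfolding L_def R_def by blast
    moreover have "card (L i' \<inter> R i) \<le> k"
    proof (cases "i < n")
      case True
      have "L i' \<inter> R i \<subseteq> b i"
      proof
        fix v
        assume "v \<in> L i' \<inter> R i"
        then obtain j l where "j < i'" "v \<in> b j" "i \<le> l" "l < n" "v \<in> b l"
          by (auto simp: L_def R_def)
        then show "v \<in> b i"
          using convex[of v j l i] that(2) by simp
      qed
      then show ?thesis
        using bag[OF True] card_mono[OF finite_subset[OF _ finite_verts]] order_trans by blast
    qed (simp add: R_def)
    ultimately show ?thesis
      by (auto simp: separation_def)
  qed
  have "sweep G k (L 0, R 0) (L i, R i)" if "i \<le> n" for i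
    using that
  proof (induction i)
    case (Suc i)
    have "L i \<subseteq> L (Suc i)" "R (Suc i) \<subseteq> R i"
      unfolding L_def R_def by (intro UN_mono; auto)+
    then have "sweep_step G k (L i, R i) (L (Suc i), R i)"
      "sweep_step G k (L (Suc i), R i) (L (Suc i), R (Suc i))"
      using sep[of i i] sep[of i "Suc i"] sep[of "Suc i" "Suc i"] Suc.prems
      by (simp_all add: sweep_step_def)
    then show ?case
      using Suc by (meson Suc_leD rtranclp.rtrancl_into_rtrancl)
  qed simp
  then have "sweep G k (L 0, R 0) (L n, R n)"
    by simp
  moreover have "L 0 = {}" "R n = {}"
    by (auto simp: L_def R_def)
  moreover have "R 0 = pverts G" "L n = pverts G"
    using sep[of 0 0] sep[of n n] \<open>L 0 = {}\<close> \<open>R n = {}\<close> by (auto simp: separation_def)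
  ultimately show ?thesis
    by simp
qed

lemma pathwidth_le_iff_sweep:
  assumes "pair_graph G"
  shows "pathwidth G + 1 \<le> int k \<longleftrightarrow> sweep G k ({}, pverts G) (pverts G, {})"
proof
  assume le: "pathwidth G + 1 \<le> int k"
  obtain T :: "nat pair_pre_digraph" and \<beta>
    where pd: "path_decomposition G T \<beta>" and "pathwidth G = decomposition_width T \<beta>"
    using pathwidth_attained[OF assms] .
  then have "Max ((\<lambda>t. card (\<beta> t)) ` pverts T) \<le> k"
    using le by (simp add: decomposition_width_def)
  moreover have "finite (pverts T)"
    using pd by (auto simp: path_decomposition_def path_graph_def)
  ultimately have "card (\<beta> t) \<le> k" if "t \<in> pverts T" for t
    using that by (meson Max_ge finite_imageI imageI order_trans)
  then show "sweep G k ({}, pverts G) (pverts G, {})"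
    using sweep_if_path_decomposition[OF assms pd] by blast
qed (rule pathwidth_le_if_sweep[OF assms])

section \<open>Blockages in strong products\<close>

text \<open>Relational image at \<open>x\<close> is the fibre over \<open>x\<close>. A fibre with
  more than \<open>l\<close> separator vertices counts as blocked both for \<open>(L, R)\<close> and
  for \<open>(R, L)\<close>, so such \<open>x\<close> will form the separator induced in
  \<open>G\<close>.\<close>

definition blocked_fibres ::
    "'a pair_pre_digraph \<Rightarrow> nat \<Rightarrow> 'b set set \<Rightarrow> ('a \<times> 'b) set \<Rightarrow> ('a \<times> 'b) set \<Rightarrow> 'a set" where
  "blocked_fibres G l P L R =
     {x \<in> pverts G. \<not> (card (L `` {x} \<inter> R `` {x}) \<le> l \<and> L `` {x} \<in> P)}"

text \<open>If \<open>A \<in> P\<close>, then \<open>B\<close>, and hence the larger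
  \<open>B'\<close>, is not in \<open>P\<close>, so \<open>A'\<close> is. The converse is
  down-closure.\<close>

lemma blockage_separation_mono:
  assumes "blockage G k P" and "separation G k A B" and "separation G k A' B'"
    and "A \<subseteq> A'" and "B \<subseteq> B'"
  shows "A \<in> P \<longleftrightarrow> A' \<in> P"
  using assms unfolding blockage_def down_closed_def by metis

lemma blockage_trivial:
  assumes "pair_graph G" and "blockage G k P"
  shows "{} \<in> P" and "pverts G \<notin> P"
proof -
  have "({} \<in> P) \<noteq> (pverts G \<in> P)" "pverts G \<in> P \<Longrightarrow> {} \<in> P"
    using assms(2) separation_trivial[OF assms(1)] by (auto simp: blockage_def down_closed_def)
  then show "{} \<in> P" and "pverts G \<notin> P"
    by auto
qed

lemma blocked_fibres_mono:
  assumes "down_closed P" and "finite L'" and "L \<subseteq> L'" and "R \<subseteq> R'"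
  shows "blocked_fibres G l P L R \<subseteq> blocked_fibres G l P L' R'"
proof
  fix x
  assume x: "x \<in> blocked_fibres G l P L R"
  have sub: "L `` {x} \<subseteq> L' `` {x}" "L `` {x} \<inter> R `` {x} \<subseteq> L' `` {x} \<inter> R' `` {x}"
    using assms by auto
  moreover have "finite (L' `` {x} \<inter> R' `` {x})"
    using assms(2) by (auto intro: finite_Image)
  ultimately have "card (L `` {x} \<inter> R `` {x}) \<le> card (L' `` {x} \<inter> R' `` {x})"
    by (intro card_mono)
  then show "x \<in> blocked_fibres G l P L' R'"
    using x sub(1) assms(1) unfolding blocked_fibres_def down_closed_def by auto
qed

text \<open>Over a light fibre \<open>(L, R)\<close> restricts to a separation of \<open>H\<close>,
  so exactly one of its sides is in \<open>P\<close>. Neighbouring light fibres agree on which one,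
  and every heavy fibre uses at least \<open>l + 1\<close> vertices of \<open>L \<inter> R\<close>,
  so at most \<open>k\<close> fibres are heavy.\<close>

lemma separation_blocked_fibres:
  assumes "pair_graph G" and "pair_graph H" and P: "blockage H l P"
    and LR: "separation (G \<boxtimes> H) m L R" and m: "m < (k + 1) * (l + 1)"
  shows "separation G k (blocked_fibres G l P L R) (blocked_fibres G l P R L)"
proof -
  interpret G: pair_graph G by fact
  interpret H: pair_graph H by fact
  let ?A = "blocked_fibres G l P L R" and ?B = "blocked_fibres G l P R L"
  have cover: "L \<union> R = pverts G \<times> pverts H"
    using LR by (auto simp: separation_def strong_product_def)
  then have fin: "finite L" "finite R"
    by (metis G.finite_verts H.finite_verts finite_SigmaI finite_Un)+
  have adj: "{(x, h), (y, h')} \<subseteq> L \<or> {(x, h), (y, h')} \<subseteq> R"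
    if "x = y \<and> x \<in> pverts G \<and> (h, h') \<in> parcs H \<or> (x, y) \<in> parcs G \<and> h = h' \<and> h \<in> pverts H
      \<or> (x, y) \<in> parcs G \<and> (h, h') \<in> parcs H" for x y h h'
  proof -
    have "((x, h), (y, h')) \<in> parcs (G \<boxtimes> H)"
      using that by (auto simp: strong_product_def dest: G.in_arcsD1 G.in_arcsD2 H.in_arcsD1 H.in_arcsD2)
    then show ?thesis
      using LR by (auto simp: separation_def)
  qed
  have fibre: "separation H l (L `` {x}) (R `` {x})"
    if "x \<in> pverts G" "card (L `` {x} \<inter> R `` {x}) \<le> l" for x
  proof -
    have "L `` {x} \<union> R `` {x} = pverts H"
      using cover that(1) by auto
    moreover have "{u, v} \<subseteq> L `` {x} \<or> {u, v} \<subseteq> R `` {x}" if "(u, v) \<in> parcs H" for u v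
      using adj[of x x u v] that \<open>x \<in> pverts G\<close> by auto
    ultimately show ?thesis
      using that(2) by (auto simp: separation_def)
  qed
  have inA: "x \<in> ?A \<or> x \<in> ?B" if "x \<in> pverts G" for x
    using fibre[OF that] P that by (auto simp: blocked_fibres_def blockage_def Int_commute)
  \<comment> \<open>Here the fibre of \<open>L\<close> at \<open>z\<close> and the fibre of
    \<open>R\<close> at \<open>w\<close> are both in \<open>P\<close>. The set \<open>D\<close>
    below forms a separation of \<open>H\<close> with the former and is contained in the latter, so
    both of its sides would be in \<open>P\<close>.\<close>
  have crossing: False if "(z, w) \<in> parcs G" "z \<notin> ?A" "w \<notin> ?B" for z w
  proof -
    have zw: "z \<in> pverts G" "w \<in> pverts G"
      using that(1) by (auto dest: G.in_arcsD1 G.in_arcsD2)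
    then have light: "card (L `` {z} \<inter> R `` {z}) \<le> l" and in_P: "L `` {z} \<in> P" "R `` {w} \<in> P"
      using that by (auto simp: blocked_fibres_def)
    \<comment> \<open>The smallest set forming a separation with the fibre of \<open>L\<close> at \<open>z\<close>.\<close>
    define D where "D = {h \<in> pverts H. h \<notin> L `` {z} \<or> (\<exists>h'. (h, h') \<in> parcs H \<and> h' \<notin> L `` {z})}"
    have "L `` {z} \<inter> D \<subseteq> L `` {z} \<inter> R `` {z}"
    proof
      fix h
      assume h: "h \<in> L `` {z} \<inter> D"
      then obtain h' where "(h, h') \<in> parcs H" "h' \<notin> L `` {z}"
        by (auto simp: D_def)
      then show "h \<in> L `` {z} \<inter> R `` {z}"
        using adj[of z z h h'] zw h by auto
    qed
    then have "card (L `` {z} \<inter> D) \<le> l"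
      using light fin by (meson card_mono finite_Image finite_Int order_trans)
    moreover have "L `` {z} \<union> D = pverts H"
      using cover by (auto simp: D_def)
    moreover have "{u, v} \<subseteq> L `` {z} \<or> {u, v} \<subseteq> D" if "(u, v) \<in> parcs H" for u v
      using that H.arcs_symmetric[OF that] by (auto simp: D_def dest: H.in_arcsD1 H.in_arcsD2)
    ultimately have "separation H l (L `` {z}) D"
      by (auto simp: separation_def)
    \<comment> \<open>A vertex missing from the fibre of \<open>L\<close> at \<open>z\<close> forces
      itself and its neighbours in \<open>H\<close> into the fibre of \<open>R\<close> at
      \<open>w\<close>. The neighbours need the diagonal edges of the strong product.\<close>
    moreover have "D \<subseteq> R `` {w}"
    proof
      fix h
      assume "h \<in> D"
      then consider "h \<in> pverts H" "h \<notin> L `` {z}"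
        | h' where "(h, h') \<in> parcs H" "h' \<notin> L `` {z}"
        by (auto simp: D_def)
      then show "h \<in> R `` {w}"
      proof cases
        case 1
        then show ?thesis
          using adj[of z w h h] that(1) by auto
      next
        case 2
        then show ?thesis
          using adj[of z w h' h] that(1) H.arcs_symmetric by auto
      qed
    qed
    ultimately show False
      using P in_P unfolding blockage_def down_closed_def by blast
  qed
  have "?A \<union> ?B = pverts G"
    using inA by (auto simp: blocked_fibres_def)
  moreover have "{u, v} \<subseteq> ?A \<or> {u, v} \<subseteq> ?B" if "(u, v) \<in> parcs G" for u v
  proof -
    have "u \<in> ?A \<or> v \<in> ?B" "v \<in> ?A \<or> u \<in> ?B" "u \<in> ?A \<or> u \<in> ?B" "v \<in> ?A \<or> v \<in> ?B"
      using crossing[of u v] crossing[of v u] inA that G.arcs_symmetric[OF that]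
      by (auto dest: G.in_arcsD1 G.in_arcsD2)
    then show ?thesis
      by auto
  qed
  moreover have "card (?A \<inter> ?B) \<le> k"
  proof (rule ccontr)
    assume "\<not> card (?A \<inter> ?B) \<le> k"
    then have "(k + 1) * (l + 1) \<le> card (?A \<inter> ?B) * (l + 1)"
      by (intro mult_right_mono) auto
    also have "\<dots> = (\<Sum>x \<in> ?A \<inter> ?B. l + 1)"
      by simp
    also have "\<dots> \<le> (\<Sum>x \<in> ?A \<inter> ?B. card (L `` {x} \<inter> R `` {x}))"
    \<comment> \<open>If the fibre were light, neither of its sides would be in \<open>P\<close>,
      although they form a separation of order at most \<open>l\<close>.\<close>
    proof (rule sum_mono)
      fix x
      assume "x \<in> ?A \<inter> ?B"
      then show "l + 1 \<le> card (L `` {x} \<inter> R `` {x})"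
        using fibre[of x] P
        by (force simp: blocked_fibres_def blockage_def Int_commute intro: ccontr)
    qed
    also have "\<dots> = card (SIGMA x : ?A \<inter> ?B. L `` {x} \<inter> R `` {x})"
      using fin by (intro card_SigmaI[symmetric]) (auto simp: blocked_fibres_def intro: finite_Image)
    also have "\<dots> \<le> card (L \<inter> R)"
      using fin by (intro card_mono) auto
    also have "\<dots> \<le> m"
      using LR by (simp add: separation_def)
    finally show False
      using m by simp
  qed
  ultimately show ?thesis
    by (auto simp: separation_def)
qed

text \<open>Whether the left side of the induced separation of \<open>G\<close> belongs to
  \<open>Q\<close> is invariant along a sweep. At the start this side is \<open>{}\<close>, at the
  end it is \<open>pverts G\<close>.\<close>

lemma no_sweep_strong_product:
  assumes "pair_graph G" and "pair_graph H" and Q: "blockage G k Q" and P: "blockage H l P"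
    and m: "m < (k + 1) * (l + 1)"
  shows "\<not> sweep (G \<boxtimes> H) m ({}, pverts (G \<boxtimes> H)) (pverts (G \<boxtimes> H), {})"
proof
  interpret H: pair_graph H by fact
  interpret GH: pair_graph "G \<boxtimes> H"
    using assms by (intro pair_graph_strong_product)
  let ?F = "blocked_fibres G l P" and ?V = "pverts (G \<boxtimes> H)"
  have mono: "?F L R \<in> Q \<longleftrightarrow> ?F L' R' \<in> Q"
    if "separation (G \<boxtimes> H) m L R" "separation (G \<boxtimes> H) m L' R'" "L \<subseteq> L'" "R \<subseteq> R'" for L R L' R'
  proof (rule blockage_separation_mono[OF Q])
    have "L' \<union> R' = ?V"
      using that(2) by (simp add: separation_def)
    then have fin: "finite L'" "finite R'"
      by (metis GH.finite_verts finite_Un)+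
    have "down_closed P"
      using P by (simp add: blockage_def)
    then show "?F L R \<subseteq> ?F L' R'" "?F R L \<subseteq> ?F R' L'"
      using that fin by (simp_all add: blocked_fibres_mono)
  qed (use that assms in \<open>auto intro: separation_blocked_fibres\<close>)
  have invariant: "?F (fst p) (snd p) \<in> Q \<longleftrightarrow> ?F (fst q) (snd q) \<in> Q"
    if "sweep (G \<boxtimes> H) m p q" for p q
    using that
  proof (induction rule: rtranclp_induct)
    case (step q r)
    have "?F (fst q) (snd q) \<in> Q \<longleftrightarrow> ?F (fst r) (snd r) \<in> Q"
      using step(2) mono[of "fst q" "snd q" "fst r" "snd r"] mono[of "fst r" "snd r" "fst q" "snd q"]
      by (auto simp: sweep_step_def)
    then show ?case
      using step by simp
  qed simp
  have "{} \<in> P" "pverts H \<notin> P" "{} \<in> Q" "pverts G \<notin> Q"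
    using blockage_trivial assms by blast+
  moreover have "?V `` {x} = pverts H" if "x \<in> pverts G" for x
    using that by (auto simp: strong_product_def)
  ultimately have "?F {} ?V = {}" "?F ?V {} = pverts G"
    by (auto simp: blocked_fibres_def)
  moreover assume "sweep (G \<boxtimes> H) m ({}, ?V) (?V, {})"
  ultimately show False
    using invariant[of "({}, ?V)" "(?V, {})"] \<open>{} \<in> Q\<close> \<open>pverts G \<notin> Q\<close> by simp
qed

theorem theorem2:
  fixes G :: "'a pair_pre_digraph" and H :: "'b pair_pre_digraph"
  assumes "pair_graph G" and "pair_graph H"
  shows "pathwidth (G \<boxtimes> H) \<ge> (pathwidth G + 1) * (pathwidth H + 1) - 1"
proof (rule ccontr)
  assume "\<not> ?thesis"
  then have lt: "pathwidth (G \<boxtimes> H) + 1 < (pathwidth G + 1) * (pathwidth H + 1)"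
    by simp
  have GH: "pair_graph (G \<boxtimes> H)"
    using assms by (rule pair_graph_strong_product)
  \<comment> \<open>An empty factor has width \<open>- 1\<close> and makes the product vanish, so
    the strict inequality forces both widths to be non-negative.\<close>
  have "- 1 \<le> pathwidth G" "- 1 \<le> pathwidth H" "- 1 \<le> pathwidth (G \<boxtimes> H)"
    using assms GH pathwidth_attained decomposition_width_ge by metis+
  with lt have "0 < (pathwidth G + 1) * (pathwidth H + 1)" "0 \<le> pathwidth G + 1" "0 \<le> pathwidth H + 1"
    by auto
  then have pos: "0 \<le> pathwidth G" "0 \<le> pathwidth H"
    by (auto simp: zero_less_mult_iff)
  \<comment> \<open>Bag size \<open>k\<close> is one too small for \<open>G\<close>, and likewise
    \<open>l\<close> for \<open>H\<close>, so both graphs have blockages; bag size \<open>m\<close>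
    suffices for the product.\<close>
  define k l m where "k = nat (pathwidth G)" and "l = nat (pathwidth H)"
    and "m = nat (pathwidth (G \<boxtimes> H) + 1)"
  have "int m < int ((k + 1) * (l + 1))"
    using lt pos \<open>- 1 \<le> pathwidth (G \<boxtimes> H)\<close> by (simp add: k_def l_def m_def algebra_simps)
  then have m: "m < (k + 1) * (l + 1)"
    by (simp only: of_nat_less_iff)
  have "\<not> sweep G k ({}, pverts G) (pverts G, {})" "\<not> sweep H l ({}, pverts H) (pverts H, {})"
    using pos by (simp_all flip: pathwidth_le_iff_sweep add: assms k_def l_def)
  then obtain P Q where "blockage G k Q" "blockage H l P"
    using assms by (meson blockage_exists)
  moreover have "sweep (G \<boxtimes> H) m ({}, pverts (G \<boxtimes> H)) (pverts (G \<boxtimes> H), {})"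
    using \<open>- 1 \<le> pathwidth (G \<boxtimes> H)\<close>
    by (simp flip: pathwidth_le_iff_sweep add: GH m_def)
  ultimately show False
    using no_sweep_strong_product assms m by blast
qed

end
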